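(* Let $G$ be a connected graph with $n\geq 3$ vertices. Then $$\frac{Kf^2(G)}{n(n-2)}-\frac{n(n-1)}{n-2}\left(\frac{1}{n\tau(G)}\right)^{\frac{2}{n-1}}\leq BH(G)\leq \frac{Kf^2(G)}{n}-n(n-1)(n-2)\left(\frac{1}{n\tau(G)}\right)^{\frac{2}{n-1}}.$$
   Context: For a graph $G$ on $n$ vertices, $L(G)=D(G)-A(G)$ is its Laplacian matrix with eigenvalues $0=\lambda_1\le\lambda_2\le\cdots\le\lambda_n$. The biharmonic index is $BH(G)=\frac12\sum_{u,v\in V(G)}d_B^2(u,v)$ with $d_B^2$ the squared biharmonic distance; equivalently $BH(G)=n\sum_{i=2}^n\lambda_i^{-2}$. The Kirchhoff index $Kf(G)$ is the sum of resistance distances over all unordered pairs of vertices; equivalently $Kf(G)=n\sum_{i=2}^n\lambda_i^{-1}$. $\tau(G)$ is the number of spanning trees of $G$. *)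

theory Defs
  imports "HOL-Analysis.Analysis"
begin

text \<open>
  A finite simple graph is given by its edge set \<open>E :: 'n set set\<close>; its vertex set is the whole
  of the finite type \<open>'n\<close>, so that its matrices are of type \<open>real ^ 'n ^ 'n\<close>.
  The notions of tree and forest in the AFP entry Graph Theory are not used: they concern directed
  cycles, and a pair of opposite arcs already counts as a cycle there.
\<close>

definition simple_graph :: "'n set set \<Rightarrow> bool" where
  "simple_graph E \<longleftrightarrow> (\<forall>e\<in>E. card e = 2)"

definition graph_connected :: "'n set set \<Rightarrow> bool" where
  "graph_connected E \<longleftrightarrow> (\<forall>u v. (u, v) \<in> {(x, y). {x, y} \<in> E}\<^sup>*)"

definition is_cycle :: "'n set set \<Rightarrow> 'n list \<Rightarrow> bool" where
  "is_cycle E c \<longleftrightarrow> length c \<ge> 3 \<and> distinct c \<and>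
     (\<forall>i < length c. {c ! i, c ! (Suc i mod length c)} \<in> E)"

definition is_tree :: "'n set set \<Rightarrow> bool" where
  "is_tree T \<longleftrightarrow> graph_connected T \<and> (\<nexists>c. is_cycle T c)"

text \<open>
  A spanning tree is identified with its edge set; it spans because \<open>is_tree T\<close> refers to
  the graph on all of \<open>'n\<close> with edge set \<open>T\<close>.
\<close>

definition num_spanning_trees :: "'n set set \<Rightarrow> nat" where
  "num_spanning_trees E = card {T. T \<subseteq> E \<and> is_tree T}"

definition adjacency_matrix :: "'n::finite set set \<Rightarrow> real ^ 'n ^ 'n" where
  "adjacency_matrix E = (\<chi> u v. if {u, v} \<in> E then 1 else 0)"

definition degree_matrix :: "'n::finite set set \<Rightarrow> real ^ 'n ^ 'n" where
  "degree_matrix E = (\<chi> u v. if u = v then real (card {e \<in> E. u \<in> e}) else 0)"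

definition laplacian :: "'n::finite set set \<Rightarrow> real ^ 'n ^ 'n" where
  "laplacian E = degree_matrix E - adjacency_matrix E"

text \<open>
  The Moore--Penrose inverse, by the four Penrose equations, which have exactly one solution for
  every real matrix.
\<close>

definition is_pseudoinverse :: "real ^ 'n ^ 'm \<Rightarrow> real ^ 'm ^ 'n \<Rightarrow> bool" where
  "is_pseudoinverse A X \<longleftrightarrow>
     A ** X ** A = A \<and> X ** A ** X = X \<and>
     transpose (A ** X) = A ** X \<and> transpose (X ** A) = X ** A"

definition pseudoinverse :: "real ^ 'n ^ 'm \<Rightarrow> real ^ 'm ^ 'n" where
  "pseudoinverse A = (THE X. is_pseudoinverse A X)"

text \<open>
  The squared biharmonic distance \<open>d\<^sub>B\<^sup>2(u,v)\<close>, from the Moore--Penrose inverse of the squared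
  Laplacian.
\<close>

definition biharmonic_dist_sq :: "'n::finite set set \<Rightarrow> 'n \<Rightarrow> 'n \<Rightarrow> real" where
  "biharmonic_dist_sq E u v =
     (let M = pseudoinverse (laplacian E ** laplacian E)
      in M $ u $ u + M $ v $ v - 2 * M $ u $ v)"

definition biharmonic_index :: "'n::finite set set \<Rightarrow> real" where
  "biharmonic_index E = 1 / 2 * (\<Sum>u\<in>UNIV. \<Sum>v\<in>UNIV. biharmonic_dist_sq E u v)"

text \<open>
  The resistance distance is the effective resistance between \<open>u\<close> and \<open>v\<close> when every edge is a
  unit resistor: a unit current is injected at \<open>u\<close> and extracted at \<open>v\<close>, the vertex potentials
  \<open>p\<close> then satisfy Kirchhoff's current law \<open>L p = e\<^sub>u - e\<^sub>v\<close>, and the resistance is the potential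
  difference. In a connected graph \<open>p\<close> exists and is unique up to an additive constant.
\<close>

definition resistance_dist :: "'n::finite set set \<Rightarrow> 'n \<Rightarrow> 'n \<Rightarrow> real" where
  "resistance_dist E u v =
     (THE r. \<exists>p. laplacian E *v p = axis u 1 - axis v 1 \<and> r = p $ u - p $ v)"

text \<open>
  The double sum counts every unordered pair of distinct vertices twice, and its diagonal
  terms vanish.
\<close>

definition kirchhoff_index :: "'n::finite set set \<Rightarrow> real" where
  "kirchhoff_index E = 1 / 2 * (\<Sum>u\<in>UNIV. \<Sum>v\<in>UNIV. resistance_dist E u v)"

end

theory Submission
  imports Defs "HOL-Library.Transitive_Closure_Table"
begin

text \<open>
  Put \<open>m = n - 1\<close> and let \<open>x\<^sub>1, \<dots>, x\<^sub>m\<close> be the inverses of the nonzero Laplacian eigenvalues, so that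
  \<open>Kf = n (\<Sum> x\<^sub>i)\<close>, \<open>BH = n (\<Sum> x\<^sub>i\<^sup>2)\<close> and, by the matrix tree theorem, \<open>\<Prod> x\<^sub>i = 1 / (n \<tau>)\<close>.
  With \<open>G = (\<Prod> x\<^sub>i)\<^bsup>2/m\<^esup>\<close> the lower bound is Kober's inequality
  \<open>(\<Sum> x\<^sub>i)\<^sup>2 \<le> (m - 1) (\<Sum> x\<^sub>i\<^sup>2) + m G\<close>, and the upper bound is the arithmetic--geometric mean inequality
  for the products \<open>x\<^sub>i x\<^sub>j\<close> over the ordered pairs \<open>i \<noteq> j\<close>.

  The matrix tree theorem is used in the form \<open>det (J + L) = n\<^sup>2 \<tau>\<close>, where \<open>J\<close> is the all-ones matrix.
  Since \<open>J + L\<close> is the sum of \<open>w w\<^sup>T\<close> over the all-ones vector and the signed incidence vectors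
  \<open>w\<close> of the edges, the Cauchy--Binet formula reduces it to sets of \<open>n\<close> of these vectors; such a set
  contributes only if it consists of the all-ones vector and the edges of a spanning tree.
\<close>

section \<open>Inequalities between symmetric means\<close>

text \<open>Convexity puts \<open>exp\<close> above its tangent at \<open>v\<close>. Summing such
  tangents at a mean of logarithms yields weighted arithmetic--geometric mean inequalities.\<close>

lemma exp_tangent: "exp v * (1 + u - v) \<le> exp (u :: real)"
proof -
  have "exp v * (1 + (u - v)) \<le> exp v * exp (u - v)"
    by (intro mult_left_mono exp_ge_add_one_self) auto
  then show ?thesis
    by (simp add: exp_diff algebra_simps)
qed

text \<open>Each \<open>f a\<close> is bounded below by the tangent of \<open>exp\<close> at the
  mean logarithm \<open>m\<close>; the linear terms cancel in the sum. The exponential of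
  \<open>m\<close> is the geometric mean.\<close>

lemma am_gm:
  fixes f :: "'a \<Rightarrow> real"
  assumes "finite A" "A \<noteq> {}" "\<And>a. a \<in> A \<Longrightarrow> f a > 0"
  shows "real (card A) * exp ((\<Sum>a\<in>A. ln (f a)) / card A) \<le> (\<Sum>a\<in>A. f a)"
proof -
  define m where "m = (\<Sum>a\<in>A. ln (f a)) / card A"
  have c: "real (card A) > 0"
    using assms by (simp add: card_gt_0_iff)
  have "exp m * (\<Sum>a\<in>A. 1 + ln (f a) - m) \<le> (\<Sum>a\<in>A. f a)"
    unfolding sum_distrib_left
  proof (rule sum_mono)
    fix a assume "a \<in> A"
    then show "exp m * (1 + ln (f a) - m) \<le> f a"
      using exp_tangent[of m "ln (f a)"] assms(3) by simp
  qed
  also have "(\<Sum>a\<in>A. 1 + ln (f a) - m) = real (card A)"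
    using c by (simp add: sum.distrib sum_subtractf m_def)
  finally show ?thesis
    by (simp add: m_def mult.commute)
qed

lemma sum_sq_le_card_sum_sq:
  fixes x :: "'a \<Rightarrow> real"
  shows "(\<Sum>i\<in>A. x i)\<^sup>2 \<le> real (card A) * (\<Sum>i\<in>A. (x i)\<^sup>2)"
  using Cauchy_Schwarz_ineq_sum[of "\<lambda>_. 1" x A] by simp

text \<open>Kober's inequality for the numbers \<open>(x i)\<^sup>2\<close>. The induction removes the smallest number,
  so that it is at most the geometric and arithmetic means of the others.\<close>

lemma kober_inequality:
  fixes x :: "'a \<Rightarrow> real"
  assumes "finite A" "A \<noteq> {}" "\<And>i. i \<in> A \<Longrightarrow> x i > 0"
  shows "(\<Sum>i\<in>A. x i)\<^sup>2
    \<le> (real (card A) - 1) * (\<Sum>i\<in>A. (x i)\<^sup>2) + card A * exp (2 * (\<Sum>i\<in>A. ln (x i)) / card A)"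
  using assms
proof (induction "card A" arbitrary: A)
  case 0
  then show ?case by simp
next
  case (Suc k)
  show ?case
  proof (cases "k = 0")
    case True
    with Suc obtain a where A: "A = {a}"
      by (metis One_nat_def card_1_singletonE)
    have "exp (2 * ln (x a)) = (x a)\<^sup>2"
      using Suc.prems(3)[of a] A by (simp add: exp_double)
    with A show ?thesis by simp
  next
    case False
    obtain i where i: "i \<in> A" "\<And>j. j \<in> A \<Longrightarrow> x i \<le> x j"
      using ex_min_if_finite[of "x ` A"] Suc.prems by (force simp: not_less)
    define B where "B = A - {i}"
    have B: "finite B" "i \<notin> B" "A = insert i B" "card B = k"
      using Suc.prems Suc.hyps(2)[symmetric] i by (auto simp: B_def)
    then have "B \<noteq> {}" using False by auto
    \<comment> \<open>\<open>t\<close> is the removed minimum and \<open>g\<close> the geometric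
      mean of the \<open>c\<close> remaining numbers.\<close>
    define s Q l g t c where "s = (\<Sum>j\<in>B. x j)" and "Q = (\<Sum>j\<in>B. (x j)\<^sup>2)"
      and "l = (\<Sum>j\<in>B. ln (x j))" and "g = exp (l / k)" and "t = x i" and "c = real k"
    have c: "c \<ge> 1" using False by (simp add: c_def)
    have t: "t > 0" using i Suc.prems by (simp add: t_def)
    have IH: "s\<^sup>2 \<le> (c - 1) * Q + c * g\<^sup>2"
      using Suc.hyps(1)[of B] Suc.prems B \<open>B \<noteq> {}\<close>
      by (simp add: s_def Q_def l_def g_def c_def exp_double[symmetric])
    have gA: "c * g \<le> s"
      using am_gm[of B x] B \<open>B \<noteq> {}\<close> Suc.prems by (simp add: s_def l_def g_def c_def)
    have "c * ln t \<le> l"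
      using sum_mono[of B "\<lambda>_. ln t" "\<lambda>j. ln (x j)"] i B Suc.prems t
      by (simp add: l_def c_def t_def)
    then have "ln t \<le> l / k"
      using c by (simp add: c_def field_simps)
    then have tg: "t \<le> g"
      using t by (metis exp_le_cancel_iff exp_ln g_def)
    \<comment> \<open>Because \<open>t \<le> g \<le> s / c\<close>, the nonnegative differences
      \<open>g - t\<close> and \<open>s / c - t\<close> may be squared. Cauchy--Schwarz for
      \<open>s\<^sup>2\<close> then leaves a common factor \<open>c\<close> to cancel.\<close>
    have "(c * (g - t))\<^sup>2 \<le> (s - c * t)\<^sup>2"
      using tg gA c by (intro power_mono) (auto simp: algebra_simps)
    also have "\<dots> = s\<^sup>2 - 2 * c * (s * t) + c * (c * t\<^sup>2)"
      by (simp add: power2_eq_square algebra_simps)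
    also have "\<dots> \<le> c * Q - 2 * c * (s * t) + c * (c * t\<^sup>2)"
      using sum_sq_le_card_sum_sq[of x B] B by (simp add: s_def Q_def c_def)
    also have "\<dots> = c * (Q - 2 * (s * t) + c * t\<^sup>2)"
      by (simp add: algebra_simps)
    finally have "c * (c * (g - t)\<^sup>2) \<le> c * (Q - 2 * (s * t) + c * t\<^sup>2)"
      by (simp add: power2_eq_square algebra_simps)
    then have Qb: "c * (g - t)\<^sup>2 \<le> Q - 2 * (s * t) + c * t\<^sup>2"
      using c by simp
    \<comment> \<open>The square of the geometric mean of all \<open>c + 1\<close> numbers.\<close>
    define T where "T = exp (2 * (ln t + l) / (c + 1))"
    have lk: "l = c * ln g"
      using c by (simp add: g_def c_def)
    have g: "g > 0" by (simp add: g_def)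
    \<comment> \<open>Weighted arithmetic--geometric mean inequality for \<open>t\<^sup>2\<close>
      and \<open>T\<close> with weights \<open>c - 1\<close> and \<open>c + 1\<close>. Their
      weighted geometric mean is \<open>t * g\<close>, hence the tangent point
      \<open>ln t + ln g\<close>.\<close>
    have "exp (ln t + ln g) * ((c - 1) * (1 + 2 * ln t - (ln t + ln g)))
        + exp (ln t + ln g) * ((c + 1) * (1 + 2 * (ln t + l) / (c + 1) - (ln t + ln g)))
        \<le> (c - 1) * t\<^sup>2 + (c + 1) * T"
    proof (rule add_mono)
      have "exp (2 * ln t) = t\<^sup>2"
        using t by (simp add: exp_double)
      then show "exp (ln t + ln g) * ((c - 1) * (1 + 2 * ln t - (ln t + ln g))) \<le> (c - 1) * t\<^sup>2"
        using mult_left_mono[OF exp_tangent[of "ln t + ln g" "2 * ln t"], of "c - 1"] c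
        by (simp add: mult.left_commute)
      show "exp (ln t + ln g) * ((c + 1) * (1 + 2 * (ln t + l) / (c + 1) - (ln t + ln g)))
          \<le> (c + 1) * T"
        using mult_left_mono[OF exp_tangent[of "ln t + ln g" "2 * (ln t + l) / (c + 1)"], of "c + 1"] c
        by (simp add: mult.left_commute T_def)
    qed
    moreover have "(c - 1) * (1 + 2 * ln t - (ln t + ln g))
        + (c + 1) * (1 + 2 * (ln t + l) / (c + 1) - (ln t + ln g)) = 2 * c"
      using c by (simp add: lk field_simps)
    moreover have "exp (ln t + ln g) = t * g"
      using t g by (simp add: exp_add)
    ultimately have "t * g * (2 * c) \<le> (c - 1) * t\<^sup>2 + (c + 1) * T"
      by (metis distrib_left)
    \<comment> \<open>Adding \<open>IH\<close> and \<open>Qb\<close> cancels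
      \<open>c * g\<^sup>2\<close> and leaves the mixed term \<open>2 * c * t * g\<close>, which the
      weighted mean inequality absorbs.\<close>
    with IH Qb have "(s + t)\<^sup>2 \<le> c * (Q + t\<^sup>2) + (c + 1) * T"
      by (simp add: power2_eq_square algebra_simps)
    moreover have "real (card A) = c + 1"
      using B by (simp add: c_def)
    ultimately show ?thesis
      using B by (simp add: s_def Q_def T_def l_def t_def add.commute)
  qed
qed

text \<open>The right-hand side is the sum of \<open>x i * x j\<close> over ordered pairs of
  distinct indices. Each \<open>ln (x i)\<close> occurs \<open>2 * (card A - 1)\<close> times among
  their logarithms, so \<open>am_gm\<close> over these pairs gives the exponential on the
  left.\<close>

lemma maclaurin_two:
  fixes x :: "'a \<Rightarrow> real"
  assumes "finite A" "A \<noteq> {}" "\<And>i. i \<in> A \<Longrightarrow> x i > 0"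
  shows "real (card A) * (real (card A) - 1) * exp (2 * (\<Sum>i\<in>A. ln (x i)) / card A)
    \<le> (\<Sum>i\<in>A. x i)\<^sup>2 - (\<Sum>i\<in>A. (x i)\<^sup>2)"
\<comment> \<open>A singleton has no pair of distinct indices, so \<open>am_gm\<close> would not
  apply; both sides are then zero.\<close>
proof (cases "card A = 1")
  case True
  then obtain a where "A = {a}"
    by (meson card_1_singletonE)
  then show ?thesis by simp
next
  case False
  define m where "m = real (card A)"
  have "card A \<ge> 2"
    using False assms by (metis One_nat_def Suc_leI card_gt_0_iff le_neq_implies_less numeral_2_eq_2)
  then have m: "m \<ge> 2" by (simp add: m_def)
  define P where "P = Sigma A (\<lambda>i. A - {i})"
  have P: "finite P" using assms by (auto simp: P_def)
  have cP: "real (card P) = m * (m - 1)"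
    using assms m by (simp add: P_def card_SigmaI m_def of_nat_diff)
  then have "P \<noteq> {}" using m by auto
  have split: "(\<Sum>(i,j)\<in>P. h i j) = (\<Sum>i\<in>A. (\<Sum>j\<in>A. h i j) - h i i)" for h :: "'a \<Rightarrow> 'a \<Rightarrow> real"
    using assms by (simp add: P_def sum.Sigma[symmetric] sum_diff1)
  have "real (card P) * exp ((\<Sum>p\<in>P. ln (x (fst p) * x (snd p))) / card P)
      \<le> (\<Sum>p\<in>P. x (fst p) * x (snd p))"
    using assms by (intro am_gm P \<open>P \<noteq> {}\<close>) (auto simp: P_def)
  also have "(\<Sum>p\<in>P. x (fst p) * x (snd p)) = (\<Sum>i\<in>A. x i)\<^sup>2 - (\<Sum>i\<in>A. (x i)\<^sup>2)"
    using split[of "\<lambda>i j. x i * x j"]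
    by (simp add: case_prod_unfold sum_subtractf sum_product power2_eq_square)
  also have "(\<Sum>p\<in>P. ln (x (fst p) * x (snd p))) = (\<Sum>p\<in>P. ln (x (fst p)) + ln (x (snd p)))"
    using assms by (intro sum.cong refl ln_mult_pos) (auto simp: P_def)
  also have "\<dots> = 2 * (m - 1) * (\<Sum>i\<in>A. ln (x i))"
    using split[of "\<lambda>i j. ln (x i) + ln (x j)"]
    by (simp add: case_prod_unfold sum_subtractf sum.distrib m_def sum_distrib_left[symmetric]
        algebra_simps)
  also have "2 * (m - 1) * (\<Sum>i\<in>A. ln (x i)) / card P = 2 * (\<Sum>i\<in>A. ln (x i)) / m"
    using m by (simp add: cP field_simps)
  finally show ?thesis
    by (simp add: cP m_def)
qed

section \<open>Orthonormal eigenbases of symmetric matrices\<close>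

text \<open>A maximizer of the Rayleigh quotient on the compact unit sphere of \<open>S\<close> is
  an eigenvector, since its first variation inside \<open>S\<close> vanishes.\<close>

lemma self_adjoint_eigenvector:
  fixes f :: "'a::euclidean_space \<Rightarrow> 'a"
  assumes f: "linear f" and adj: "\<And>x y. f x \<bullet> y = x \<bullet> f y"
    and S: "subspace S" "f ` S \<subseteq> S" "S \<noteq> {0}"
  obtains v \<mu> where "v \<in> S" "norm v = 1" "f v = \<mu> *\<^sub>R v"
proof -
  define C where "C = S \<inter> sphere 0 1"
  have "compact C"
    unfolding C_def by (intro closed_Int_compact closed_subspace S compact_sphere)
  moreover have "C \<noteq> {}"
  proof -
    obtain w where "w \<in> S" "w \<noteq> 0"
      using S subspace_0 by blast
    then have "w /\<^sub>R norm w \<in> C"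
      using S by (simp add: C_def subspace_scale)
    then show ?thesis by blast
  qed
  moreover have "continuous_on C (\<lambda>x. x \<bullet> f x)"
    by (intro continuous_intros linear_continuous_on_compose[OF _ f])
  ultimately obtain v where v: "v \<in> C" and max: "\<And>x. x \<in> C \<Longrightarrow> x \<bullet> f x \<le> v \<bullet> f v"
    using continuous_attains_sup by metis
  define \<mu> where "\<mu> = v \<bullet> f v"
  have vS: "v \<in> S" "v \<bullet> v = 1"
    using v by (auto simp: C_def norm_eq_1)
  have bound: "x \<bullet> f x \<le> \<mu> * (x \<bullet> x)" if "x \<in> S" for x
  proof (cases "x = 0")
    case False
    define y where "y = x /\<^sub>R norm x"
    have "y \<in> C"
      using False that S by (simp add: y_def C_def subspace_scale)
    then have "y \<bullet> f y \<le> \<mu>"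
      using max \<mu>_def by simp
    moreover have "x = norm x *\<^sub>R y"
      using False by (simp add: y_def)
    then have "x \<bullet> f x = (norm x)\<^sup>2 * (y \<bullet> f y)"
      by (metis f inner_commute inner_scaleR_left linear_scale mult.assoc power2_eq_square)
    ultimately show ?thesis
      by (simp add: mult.commute mult_right_mono power2_norm_eq_inner[symmetric])
  qed (use f in \<open>simp add: linear_0\<close>)
  \<comment> \<open>The residual lies in \<open>S\<close>, so \<open>v\<close> may be perturbed in
    its direction; the aim is \<open>w = 0\<close>.\<close>
  define w where "w = f v - \<mu> *\<^sub>R v"
  have w: "w \<in> S"
    using S vS by (auto simp: w_def intro!: subspace_diff subspace_scale)
  define g where "g = \<mu> * (w \<bullet> w) - w \<bullet> f w"
  \<comment> \<open>Maximality at \<open>v + t w\<close>, divided by \<open>t\<close>. The terms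
    free of \<open>t\<close> cancel, the linear one is \<open>- 2 * (w \<bullet> w)\<close>, and
    letting \<open>t\<close> tend to 0 from the right forces
    \<open>w \<bullet> w \<le> 0\<close>.\<close>
  have "2 * (w \<bullet> w) \<le> t * g" if t: "t > 0" for t
  proof -
    have "v + t *\<^sub>R w \<in> S"
      using S vS w by (intro subspace_add subspace_scale)
    from bound[OF this] have "0 \<le> \<mu> * ((v + t *\<^sub>R w) \<bullet> (v + t *\<^sub>R w)) - (v + t *\<^sub>R w) \<bullet> f (v + t *\<^sub>R w)"
      by simp
    also have "(v + t *\<^sub>R w) \<bullet> (v + t *\<^sub>R w) = 1 + 2 * t * (v \<bullet> w) + t * t * (w \<bullet> w)"
      using vS by (simp add: inner_add_left inner_add_right inner_commute[of w v] ring_distribs)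
    also have "(v + t *\<^sub>R w) \<bullet> f (v + t *\<^sub>R w) = \<mu> + 2 * t * (f v \<bullet> w) + t * t * (w \<bullet> f w)"
    proof -
      have "w \<bullet> f v = f v \<bullet> w" "v \<bullet> f w = f v \<bullet> w"
        by (rule inner_commute, rule adj[symmetric])
      then show ?thesis
        by (simp add: linear_add[OF f] linear_scale[OF f] inner_add_left inner_add_right \<mu>_def ring_distribs)
    qed
    also have "\<mu> * (1 + 2 * t * (v \<bullet> w) + t * t * (w \<bullet> w))
        - (\<mu> + 2 * t * (f v \<bullet> w) + t * t * (w \<bullet> f w))
        = t * t * g + 2 * t * (\<mu> * (v \<bullet> w) - f v \<bullet> w)"
      by (simp add: g_def algebra_simps)
    also have "\<mu> * (v \<bullet> w) - f v \<bullet> w = - (w \<bullet> w)"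
      by (simp add: w_def inner_simps algebra_simps)
    finally have "0 \<le> t * (t * g - 2 * (w \<bullet> w))"
      by (simp add: algebra_simps)
    with t show ?thesis
      by (simp add: zero_le_mult_iff)
  qed
  then have "\<forall>\<^sub>F t in at_right 0. 2 * (w \<bullet> w) \<le> t * g"
    by (auto simp: eventually_at_filter)
  moreover have "((\<lambda>t. t * g) \<longlongrightarrow> 0 * g) (at_right 0)"
    by (intro tendsto_intros)
  ultimately have "2 * (w \<bullet> w) \<le> 0 * g"
    by (intro tendsto_lowerbound) auto
  then have "w \<bullet> w \<le> 0"
    by simp
  then have "w = 0"
    using inner_gt_zero_iff[of w] by linarith
  then have "f v = \<mu> *\<^sub>R v"
    by (simp add: w_def)
  with that vS show ?thesis
    by (simp add: norm_eq_1)
qed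

text \<open>Induction on the dimension: split off a unit eigenvector; self-adjointness keeps its
  orthogonal complement in \<open>S\<close> invariant.\<close>

lemma self_adjoint_orthonormal_eigenbasis:
  fixes f :: "'a::euclidean_space \<Rightarrow> 'a"
  assumes f: "linear f" and adj: "\<And>x y. f x \<bullet> y = x \<bullet> f y"
    and S: "subspace S" "f ` S \<subseteq> S"
  obtains B where "B \<subseteq> S" "finite B" "card B = dim S" "pairwise orthogonal B"
    "\<And>b. b \<in> B \<Longrightarrow> norm b = 1 \<and> (\<exists>\<mu>. f b = \<mu> *\<^sub>R b)"
proof -
  have "\<exists>B\<subseteq>S. finite B \<and> card B = dim S \<and> pairwise orthogonal B \<and>
      (\<forall>b\<in>B. norm b = 1 \<and> (\<exists>\<mu>. f b = \<mu> *\<^sub>R b))"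
    using S
  proof (induction "dim S" arbitrary: S)
    case 0
    then show ?case by (intro exI[of _ "{}"]) auto
  next
    case (Suc d)
    then have "S \<noteq> {0}" by auto
    then obtain v \<mu> where v: "v \<in> S" "norm v = 1" "f v = \<mu> *\<^sub>R v"
      using self_adjoint_eigenvector[OF f adj] Suc.prems by metis
    define T where "T = {y \<in> S. \<forall>x\<in>span {v}. orthogonal x y}"
    have T: "T = {y \<in> S. orthogonal v y}"
      by (auto simp: T_def span_singleton orthogonal_def)
    have subT: "subspace T"
      using Suc.prems by (auto simp: T subspace_def orthogonal_clauses)
    have "span {v} \<subseteq> S"
      using Suc.prems v by (intro span_minimal) auto
    then have "dim T + dim (span {v}) = dim S"
      unfolding T_def using Suc.prems by (intro dim_subspace_orthogonal_to_vectors subspace_span)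
    moreover have "dim (span {v}) = 1"
      using v by (auto simp: dim_insert)
    ultimately have dT: "dim T = d" using Suc.hyps(2) by simp
    have "f ` T \<subseteq> T"
      using Suc.prems v by (auto simp: T orthogonal_def adj[symmetric])
    with Suc.hyps(1)[OF dT[symmetric] subT] dT obtain B
      where B: "B \<subseteq> T" "finite B" "card B = d" "pairwise orthogonal B"
        "\<forall>b\<in>B. norm b = 1 \<and> (\<exists>\<mu>. f b = \<mu> *\<^sub>R b)"
      by metis
    have "v \<notin> B"
      using B(1) v by (auto simp: T orthogonal_def)
    moreover have "pairwise orthogonal (insert v B)"
      using B by (auto simp: pairwise_insert T orthogonal_commute)
    ultimately show ?case
      using B v Suc.hyps(2) by (intro exI[of _ "insert v B"]) (auto simp: T)
  qed
  with that show ?thesis by metis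
qed

text \<open>The given eigenvector \<open>u\<close> is completed by an eigenbasis of its orthogonal
  complement. Prescribing \<open>u\<close> later makes the constant vector a member of the Laplacian
  eigenbasis.\<close>

lemma symmetric_matrix_orthonormal_eigenbasis:
  fixes A :: "real ^ 'n ^ 'n"
  assumes sym: "transpose A = A" and u: "norm u = 1" "A *v u = \<mu> *\<^sub>R u"
  obtains q :: "'n \<Rightarrow> real ^ 'n" and r lam where "q r = u"
    "\<And>i j. q i \<bullet> q j = (if i = j then 1 else 0)" "\<And>i. A *v q i = lam i *\<^sub>R q i"
proof -
  define T where "T = {y \<in> UNIV. \<forall>x\<in>span {u}. orthogonal x y}"
  have T: "T = {y. orthogonal u y}"
    by (auto simp: T_def span_singleton orthogonal_def)
  have adj: "(A *v x) \<bullet> y = x \<bullet> (A *v y)" for x y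
    by (metis dot_lmul_matrix sym transpose_matrix_vector)
  have "dim T + dim (span {u}) = dim (UNIV :: (real ^ 'n) set)"
    unfolding T_def by (intro dim_subspace_orthogonal_to_vectors) auto
  moreover have "dim (span {u}) = 1"
    using u by (auto simp: dim_insert)
  ultimately have dT: "Suc (dim T) = CARD('n)" by simp
  have "subspace T"
    by (simp add: T subspace_orthogonal_to_vector)
  moreover have "(*v) A ` T \<subseteq> T"
    using u by (auto simp: T orthogonal_def adj[symmetric])
  ultimately obtain B where B: "B \<subseteq> T" "finite B" "card B = dim T" "pairwise orthogonal B"
      "\<And>b. b \<in> B \<Longrightarrow> norm b = 1 \<and> (\<exists>\<mu>. A *v b = \<mu> *\<^sub>R b)"
    using self_adjoint_orthonormal_eigenbasis[of "(*v) A" T] adj by auto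
  define C where "C = insert u B"
  have "u \<notin> B"
    using B(1) u by (auto simp: T orthogonal_def)
  then have "card C = CARD('n)"
    using B dT by (simp add: C_def)
  then obtain q where q: "bij_betw q (UNIV :: 'n set) C"
    by (metis B(2) C_def finite_class.finite_UNIV finite_insert finite_same_card_bij)
  obtain r where r: "q r = u"
    using q by (metis C_def bij_betw_imp_surj_on imageE insertI1)
  have qC: "q i \<in> C" for i
    using q by (auto simp: bij_betw_def)
  have "\<forall>i. \<exists>l. A *v q i = l *\<^sub>R q i"
    using qC B(5) u unfolding C_def by (metis insert_iff)
  then obtain lam where lam: "\<And>i. A *v q i = lam i *\<^sub>R q i"
    by metis
  have "pairwise orthogonal C"
    using B by (auto simp: C_def pairwise_insert T orthogonal_commute)
  then have "q i \<bullet> q j = 0" if "i \<noteq> j" for i j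
    using q qC that by (metis bij_betw_def inj_eq orthogonal_def pairwise_def)
  moreover have "q i \<bullet> q i = 1" for i
    using qC[of i] B(5) u by (auto simp: C_def norm_eq_1)
  ultimately show ?thesis
    using that[of q r lam] r lam by auto
qed

text \<open>The sum of \<open>d i\<close> times the outer square of \<open>q i\<close>. With one
  orthonormal \<open>q\<close>, varying \<open>d\<close> represents the Laplacian, its square and
  their pseudoinverses.\<close>

definition spectral_matrix :: "('n \<Rightarrow> real ^ 'n) \<Rightarrow> ('n \<Rightarrow> real) \<Rightarrow> real ^ 'n ^ 'n" where
  "spectral_matrix q d = (\<chi> u v. \<Sum>i\<in>UNIV. d i * q i $ u * q i $ v)"

lemma transpose_spectral_matrix [simp]: "transpose (spectral_matrix q d) = spectral_matrix q d"
  by (simp add: spectral_matrix_def transpose_def mult.assoc mult.left_commute vec_eq_iff mult.commute)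

lemma spectral_matrix_mult_vec:
  "spectral_matrix q d *v x = (\<Sum>i\<in>UNIV. (d i * (q i \<bullet> x)) *\<^sub>R q i)"
proof -
  have "(\<Sum>v\<in>UNIV. \<Sum>i\<in>UNIV. d i * q i $ u * q i $ v * x $ v)
      = (\<Sum>i\<in>UNIV. d i * (\<Sum>v\<in>UNIV. q i $ v * x $ v) * q i $ u)" for u
    by (subst sum.swap) (simp add: sum_distrib_left sum_distrib_right algebra_simps)
  then show ?thesis
    by (simp add: spectral_matrix_def matrix_vector_mult_def vec_eq_iff sum_distrib_right inner_vec_def)
qed

lemma spectral_matrix_decomp:
  "spectral_matrix q d
    = transpose (\<chi> i. q i) ** (\<chi> i j. if i = j then d i else 0) ** (\<chi> i. q i)"
  by (simp add: spectral_matrix_def matrix_matrix_mult_def vec_eq_iff transpose_def sum.delta'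
      if_distrib[where f = "\<lambda>x. _ * x"] mult.commute mult.left_commute cong: if_cong)

locale orthonormal_family =
  fixes q :: "'n::finite \<Rightarrow> real ^ 'n"
  assumes orthonormal: "q i \<bullet> q j = (if i = j then 1 else 0)"
begin

text \<open>Orthonormality says that the matrix with rows \<open>q i\<close> times its transpose is
  the identity. A one-sided inverse of a square matrix is two-sided, which gives completeness of the
  family.\<close>

lemma rows_orthogonal: "transpose (\<chi> i. q i) ** (\<chi> i. q i) = mat 1"
proof -
  have "(\<chi> i. q i) ** transpose (\<chi> i. q i) = mat 1"
    by (simp add: matrix_mult_transpose_dot_row vec_eq_iff row_def orthonormal mat_def)
  then show ?thesis
    by (rule matrix_left_right_inverse1)
qed

lemma spectral_matrix_one: "spectral_matrix q (\<lambda>i. 1) = mat 1"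
proof -
  have "(\<chi> i j. if i = j then 1 else 0) = (mat 1 :: real ^ 'n ^ 'n)"
    by (simp add: mat_def)
  then show ?thesis
    by (simp add: spectral_matrix_decomp rows_orthogonal)
qed

lemma expansion: "x = (\<Sum>i\<in>UNIV. (q i \<bullet> x) *\<^sub>R q i)"
  using spectral_matrix_mult_vec[of q "\<lambda>i. 1" x] by (simp add: spectral_matrix_one)

lemma matrix_eq_spectral_matrix:
  assumes "\<And>i. A *v q i = d i *\<^sub>R q i"
  shows "A = spectral_matrix q d"
  unfolding matrix_eq
proof
  fix x
  have "A *v x = (\<Sum>i\<in>UNIV. (q i \<bullet> x) *\<^sub>R (A *v q i))"
    by (subst expansion) (simp add: linear_sum linear_scale o_def)
  then show "A *v x = spectral_matrix q d *v x"
    by (simp add: assms spectral_matrix_mult_vec mult.commute)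
qed

lemma spectral_matrix_mult_eigenvec: "spectral_matrix q d *v q j = d j *\<^sub>R q j"
  by (simp add: spectral_matrix_mult_vec orthonormal if_distrib[where f = "\<lambda>x. (_ * x) *\<^sub>R _"]
      cong: if_cong)

lemma spectral_matrix_mult:
  "spectral_matrix q d ** spectral_matrix q e = spectral_matrix q (\<lambda>i. d i * e i)"
  by (intro matrix_eq_spectral_matrix)
    (simp add: matrix_vector_mul_assoc[symmetric] spectral_matrix_mult_eigenvec
      matrix_vector_mult_scaleR mult.commute)

lemma trace_spectral_matrix: "trace (spectral_matrix q d) = (\<Sum>i\<in>UNIV. d i)"
proof -
  have "trace (spectral_matrix q d) = (\<Sum>i\<in>UNIV. d i * (q i \<bullet> q i))"
    unfolding trace_def spectral_matrix_def inner_vec_def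
    by (simp add: sum_distrib_left mult.assoc) (rule sum.swap)
  then show ?thesis
    by (simp add: orthonormal)
qed

lemma det_spectral_matrix: "det (spectral_matrix q d) = (\<Prod>i\<in>UNIV. d i)"
proof -
  have "det (transpose (\<chi> i. q i)) * det (\<chi> i. q i) = 1"
    by (metis det_I det_mul rows_orthogonal)
  then show ?thesis
    by (simp add: spectral_matrix_decomp det_mul det_diagonal algebra_simps)
qed

end

section \<open>Spanning trees\<close>

definition adj_rel :: "'n set set \<Rightarrow> ('n \<times> 'n) set" where
  "adj_rel E = {(x, y). {x, y} \<in> E}"

lemma graph_connected_iff: "graph_connected E \<longleftrightarrow> (\<forall>u v. (u, v) \<in> (adj_rel E)\<^sup>*)"
  by (simp add: graph_connected_def adj_rel_def)

lemma sym_adj_rel_rtrancl: "sym ((adj_rel E)\<^sup>*)"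
  by (intro sym_rtrancl) (auto simp: sym_def adj_rel_def insert_commute)

text \<open>Breadth-first search: \<open>d\<close> is the distance from \<open>r\<close>, and
  \<open>p v\<close> precedes \<open>v\<close> on a shortest path. The pair encodes a rooted
  spanning tree.\<close>

lemma connected_parents:
  assumes "graph_connected E"
  obtains p and d :: "'n \<Rightarrow> nat" where "\<And>v. v \<noteq> r \<Longrightarrow> {v, p v} \<in> E" "\<And>v. v \<noteq> r \<Longrightarrow> d (p v) < d v"
proof -
  define d where "d v = (LEAST k. (r, v) \<in> adj_rel E ^^ k)" for v
  have d: "(r, v) \<in> adj_rel E ^^ d v" for v
    unfolding d_def using assms by (metis LeastI_ex graph_connected_iff rtrancl_imp_relpow)
  have "\<exists>w. {v, w} \<in> E \<and> d w < d v" if "v \<noteq> r" for v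
  proof (cases "d v")
    case 0
    with d[of v] that show ?thesis by simp
  next
    case (Suc k)
    with d[of v] obtain w where w: "(r, w) \<in> adj_rel E ^^ k" "(w, v) \<in> adj_rel E"
      by auto
    then have "d w \<le> k"
      unfolding d_def by (intro Least_le)
    with w Suc show ?thesis
      by (auto simp: adj_rel_def insert_commute)
  qed
  then obtain p where "\<And>v. v \<noteq> r \<Longrightarrow> {v, p v} \<in> E \<and> d (p v) < d v"
    by metis
  with that show ?thesis by blast
qed

text \<open>If distinct \<open>v\<close> and \<open>w\<close> had the same parent edge, each would
  be the parent of the other, and \<open>d\<close> would decrease both ways.\<close>

lemma parent_edges_inj:
  fixes d :: "'n \<Rightarrow> nat"
  assumes "\<And>v. v \<noteq> r \<Longrightarrow> d (p v) < d v"
  shows "inj_on (\<lambda>v. {v, p v}) (- {r})"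
proof (rule inj_onI)
  fix v w assume "v \<in> - {r}" "w \<in> - {r}" "{v, p v} = {w, p w}"
  then show "v = w"
    using assms[of v] assms[of w] by (auto simp: doubleton_eq_iff)
qed

lemma card_parent_edges:
  fixes d :: "'n::finite \<Rightarrow> nat"
  assumes "\<And>v. v \<noteq> r \<Longrightarrow> d (p v) < d v"
  shows "card ((\<lambda>v. {v, p v}) ` (- {r})) = CARD('n) - 1"
  using card_image[OF parent_edges_inj[of r d p, OF assms]] by (simp add: Compl_eq_Diff_UNIV)

lemma parents_imp_connected:
  fixes d :: "'n \<Rightarrow> nat"
  assumes "\<And>v. v \<noteq> r \<Longrightarrow> {v, p v} \<in> E" and "\<And>v. v \<noteq> r \<Longrightarrow> d (p v) < d v"
  shows "graph_connected E"
proof -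
  have "(v, r) \<in> (adj_rel E)\<^sup>*" for v
  proof (induction "d v" arbitrary: v rule: less_induct)
    case less
    show ?case
    proof (cases "v = r")
      case False
      then have "(v, p v) \<in> adj_rel E"
        using assms by (simp add: adj_rel_def)
      with less assms(2) False show ?thesis
        by (meson converse_rtrancl_into_rtrancl)
    qed simp
  qed
  then show ?thesis
    unfolding graph_connected_iff by (meson rtrancl_trans sym_adj_rel_rtrancl symD)
qed

lemma connected_card_ge:
  fixes E :: "'n::finite set set"
  assumes "graph_connected E"
  shows "CARD('n) - 1 \<le> card E"
proof -
  fix r :: 'n
  obtain p d where p: "\<And>v. v \<noteq> r \<Longrightarrow> {v, p v} \<in> E" and d: "\<And>v. v \<noteq> r \<Longrightarrow> (d (p v) :: nat) < d v"
    using connected_parents[OF assms] by metis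
  have "(\<lambda>v. {v, p v}) ` (- {r}) \<subseteq> E"
    using p by auto
  then have "card ((\<lambda>v. {v, p v}) ` (- {r})) \<le> card E"
    by (rule card_mono[OF finite])
  moreover have "card ((\<lambda>v. {v, p v}) ` (- {r})) = CARD('n) - 1"
    using d by (rule card_parent_edges)
  ultimately show ?thesis
    by simp
qed

text \<open>The parent edges \<open>P\<close> already connect all vertices, so any further edge of
  \<open>T\<close> would close a cycle with a path in \<open>P\<close>. Hence \<open>T = P\<close>,
  and \<open>P\<close> can be counted.\<close>

lemma tree_card:
  fixes T :: "'n::finite set set"
  assumes "simple_graph T" "is_tree T"
  shows "card T = CARD('n) - 1"
proof -
  fix r :: 'n
  have conn: "graph_connected T" and nocyc: "\<not> is_cycle T c" for c
    using assms by (auto simp: is_tree_def)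
  obtain p d where p: "\<And>v. v \<noteq> r \<Longrightarrow> {v, p v} \<in> T" and d: "\<And>v. v \<noteq> r \<Longrightarrow> (d (p v) :: nat) < d v"
    using connected_parents[OF conn] by metis
  define P where "P = (\<lambda>v. {v, p v}) ` (- {r})"
  have PT: "P \<subseteq> T"
    using p by (auto simp: P_def)
  have P_conn: "graph_connected P"
    by (rule parents_imp_connected[of r p P d]) (auto simp: P_def d)
  have "T \<subseteq> P"
  proof
    fix e assume e: "e \<in> T"
    show "e \<in> P"
    proof (rule ccontr)
      assume eP: "e \<notin> P"
      obtain u v where uv: "e = {u, v}" "u \<noteq> v"
        using assms(1) e by (auto simp: simple_graph_def card_2_iff)
      have "(u, v) \<in> {(x, y). {x, y} \<in> P}\<^sup>*"
        using P_conn by (simp add: graph_connected_def)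
      then have "(\<lambda>x y. {x, y} \<in> P)\<^sup>*\<^sup>* u v"
        by (simp add: rtranclp_rtrancl_eq)
      then obtain ys where "rtrancl_path (\<lambda>x y. {x, y} \<in> P) u ys v"
        by (auto simp: rtranclp_eq_rtrancl_path)
      then obtain xs where xs: "rtrancl_path (\<lambda>x y. {x, y} \<in> P) u xs v" "distinct (u # xs)"
        by (rule rtrancl_path_distinct)
      have "xs \<noteq> []"
        using xs(1) uv by (auto elim: rtrancl_path.cases)
      then have last: "last xs = v"
        using xs(1) rtrancl_path_last by metis
      have edges: "{(u # xs) ! i, xs ! i} \<in> P" if "i < length xs" for i
        using rtrancl_path_nth[OF xs(1) that] .
      \<comment> \<open>\<open>xs\<close> omits the start vertex. A path of one edge would put
        \<open>e\<close> itself into \<open>P\<close>, so there are at least two edges and three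
        vertices.\<close>
      have "length xs \<noteq> 1"
        using edges[of 0] last eP uv by (auto simp: length_Suc_conv)
      then have "length (u # xs) \<ge> 3"
        using \<open>xs \<noteq> []\<close> by (cases xs; cases "tl xs") auto
      moreover have "{(u # xs) ! i, (u # xs) ! (Suc i mod length (u # xs))} \<in> T"
        if "i < length (u # xs)" for i
      proof (cases "i = length xs")
        case True
        then have "(u # xs) ! i = v"
          using \<open>xs \<noteq> []\<close> last by (simp add: last_conv_nth nth_Cons')
        with True e uv show ?thesis by (simp add: insert_commute)
      next
        case False
        with that edges[of i] PT show ?thesis by auto
      qed
      ultimately have "is_cycle T (u # xs)"
        using xs(2) unfolding is_cycle_def by blast
      with nocyc show False by blast
    qed
  qed
  with PT have "T = P" by blast
  moreover have "card P = CARD('n) - 1"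
    unfolding P_def using d by (rule card_parent_edges)
  ultimately show ?thesis
    by simp
qed

text \<open>Deleting an edge of a cycle preserves connectedness but leaves fewer than
  \<open>CARD('n) - 1\<close> edges, against \<open>connected_card_ge\<close>.\<close>

lemma connected_card_imp_tree:
  fixes T :: "'n::finite set set"
  assumes conn: "graph_connected T" and card: "card T = CARD('n) - 1"
  shows "is_tree T"
proof -
  have False if c: "is_cycle T c" for c
  proof -
    define l where "l = length c"
    have l: "l \<ge> 3" and dist: "distinct c"
      and ne: "c \<noteq> []" and edges: "\<And>i. i < l \<Longrightarrow> {c ! i, c ! (Suc i mod l)} \<in> T"
      using c by (auto simp: is_cycle_def l_def)
    define e where "e = {c ! (l - 1), c ! 0}"
    have eT: "e \<in> T"
      using edges[of "l - 1"] l by (simp add: e_def)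
    define F where "F = T - {e}"
    have path: "i < l \<Longrightarrow> (c ! 0, c ! i) \<in> (adj_rel F)\<^sup>*" for i
    proof (induction i)
      case (Suc i)
      \<comment> \<open>By distinctness, a consecutive pair could equal the closing edge
        \<open>e\<close> only with \<open>i = 0\<close> and \<open>Suc i = l - 1\<close>, which
        \<open>l \<ge> 3\<close> excludes.\<close>
      have "c ! i \<noteq> c ! (l - 1)" "c ! Suc i \<noteq> c ! 0"
        and "i \<noteq> 0 \<Longrightarrow> c ! i \<noteq> c ! 0" "i = 0 \<Longrightarrow> c ! Suc i \<noteq> c ! (l - 1)"
        using dist Suc.prems l ne by (auto simp: nth_eq_iff_index_eq l_def)
      then have "{c ! i, c ! Suc i} \<noteq> e"
        by (auto simp: e_def doubleton_eq_iff)
      moreover have "{c ! i, c ! Suc i} \<in> T"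
        using edges[of i] Suc.prems by simp
      ultimately show ?case
        using Suc by (auto simp: F_def adj_rel_def intro: rtrancl_into_rtrancl)
    qed simp
    have "(x, y) \<in> (adj_rel F)\<^sup>*" if "(x, y) \<in> adj_rel T" for x y
    proof (cases "{x, y} = e")
      case True
      then show ?thesis
        using path[of "l - 1"] l symD[OF sym_adj_rel_rtrancl, of "c ! 0" "c ! (l - 1)" F]
        by (auto simp: e_def doubleton_eq_iff)
    next
      case False
      with that show ?thesis by (auto simp: F_def adj_rel_def)
    qed
    then have "(adj_rel T)\<^sup>* \<subseteq> (adj_rel F)\<^sup>*"
      by (intro rtrancl_subset_rtrancl) auto
    then have "graph_connected F"
      using conn unfolding graph_connected_iff by blast
    then have "card T \<le> card F"
      using connected_card_ge card by metis
    moreover have "card F < card T"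
      using eT unfolding F_def by (intro card_Diff1_less) auto
    ultimately show False by simp
  qed
  with conn show ?thesis by (auto simp: is_tree_def)
qed

section \<open>The matrix tree theorem\<close>

text \<open>Multilinear expansion by rows, where \<open>g i\<close> selects the summand used in row
  \<open>i\<close>. A selection that is not injective makes two rows proportional and contributes
  nothing.\<close>

lemma det_sum_outer_products_expand:
  fixes w :: "'k \<Rightarrow> real ^ 'n"
  assumes "finite K"
  shows "det (\<chi> i j. \<Sum>k\<in>K. w k $ i * w k $ j)
    = (\<Sum>g | range g \<subseteq> K \<and> inj g. det (\<chi> i j. w (g i) $ i * w (g i) $ j))"
proof -
  have PiE: "(UNIV :: 'n set) \<rightarrow>\<^sub>E K = {g. range g \<subseteq> K}"
    by (auto simp: PiE_def)
  then have fin: "finite {g :: 'n \<Rightarrow> 'k. range g \<subseteq> K}"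
    using finite_PiE[of "UNIV :: 'n set" "\<lambda>_. K"] assms by simp
  have "det (\<chi> i j. \<Sum>k\<in>K. w k $ i * w k $ j)
      = (\<Sum>p | p permutes UNIV. of_int (sign p) *
          (\<Sum>g\<in>UNIV \<rightarrow>\<^sub>E K. \<Prod>i\<in>UNIV. w (g i) $ i * w (g i) $ p i))"
    using assms by (simp add: det_def prod_sum_PiE)
  also have "\<dots> = (\<Sum>g | range g \<subseteq> K. det (\<chi> i j. w (g i) $ i * w (g i) $ j))"
    unfolding det_def PiE by (simp add: sum_distrib_left) (rule sum.swap)
  also have "\<dots> = (\<Sum>g | range g \<subseteq> K \<and> inj g. det (\<chi> i j. w (g i) $ i * w (g i) $ j))"
  proof (rule sum.mono_neutral_right[OF fin])
    show "\<forall>g\<in>{g. range g \<subseteq> K} - {g. range g \<subseteq> K \<and> inj g}.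
        det (\<chi> i j. w (g i) $ i * w (g i) $ j) = 0"
    proof
      fix g :: "'n \<Rightarrow> 'k" assume "g \<in> {g. range g \<subseteq> K} - {g. range g \<subseteq> K \<and> inj g}"
      then have "\<not> inj g" by auto
      then obtain a b where ab: "a \<noteq> b" "g a = g b"
        by (auto simp: inj_def)
      have "det (\<chi> i j. w (g i) $ i * w (g i) $ j) = det (\<chi> i. (w (g i) $ i) *s w (g i))"
        by (rule arg_cong[of _ _ det]) (simp add: vec_eq_iff)
      also have "\<dots> = 0"
        using ab unfolding det_rows_mul by (simp add: det_identical_rows[of a b] row_def)
      finally show "det (\<chi> i j. w (g i) $ i * w (g i) $ j) = 0" .
    qed
  qed auto
  finally show ?thesis .
qed

text \<open>The Cauchy--Binet formula with each squared minor written as the determinant of a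
  partial sum. The injective selections are grouped by range, and the same expansion applied to
  \<open>S\<close> alone recovers its group.\<close>

lemma det_sum_outer_products:
  fixes w :: "'k \<Rightarrow> real ^ 'n"
  assumes "finite K"
  shows "det (\<chi> i j. \<Sum>k\<in>K. w k $ i * w k $ j)
    = (\<Sum>S | S \<subseteq> K \<and> card S = CARD('n). det (\<chi> i j. \<Sum>k\<in>S. w k $ i * w k $ j))"
proof -
  define h where "h g = det (\<chi> i j. w (g i) $ i * w (g i) $ j)" for g :: "'n \<Rightarrow> 'k"
  define G where "G = {g :: 'n \<Rightarrow> 'k. range g \<subseteq> K \<and> inj g}"
  have "finite ((UNIV :: 'n set) \<rightarrow>\<^sub>E K)"
    using assms by (intro finite_PiE) auto
  then have "finite G"
    by (rule finite_subset[rotated]) (auto simp: PiE_def G_def)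
  have "det (\<chi> i j. \<Sum>k\<in>K. w k $ i * w k $ j) = (\<Sum>g\<in>G. h g)"
    using det_sum_outer_products_expand[OF assms, of w] by (simp add: G_def h_def)
  also have "\<dots> = (\<Sum>S | S \<subseteq> K \<and> card S = CARD('n). \<Sum>g | g \<in> G \<and> range g = S. h g)"
    using assms \<open>finite G\<close>
    by (intro sum.group[symmetric]) (auto simp: G_def card_image)
  also have "\<dots> = (\<Sum>S | S \<subseteq> K \<and> card S = CARD('n). det (\<chi> i j. \<Sum>k\<in>S. w k $ i * w k $ j))"
  proof (intro sum.cong refl)
    fix S assume "S \<in> {S. S \<subseteq> K \<and> card S = CARD('n)}"
    then have S: "S \<subseteq> K" "card S = CARD('n)" by auto
    have fS: "finite S"
      using S assms finite_subset by blast
    have "range g = S" if "range g \<subseteq> S" "inj g" for g :: "'n \<Rightarrow> 'k"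
      using that S fS by (intro card_subset_eq) (auto simp: card_image)
    then have "{g \<in> G. range g = S} = {g. range g \<subseteq> S \<and> inj g}"
      using S by (auto simp: G_def)
    then show "(\<Sum>g | g \<in> G \<and> range g = S. h g) = det (\<chi> i j. \<Sum>k\<in>S. w k $ i * w k $ j)"
      using det_sum_outer_products_expand[OF fS, of w] by (simp add: h_def)
  qed
  finally show ?thesis .
qed

text \<open>The measure \<open>m\<close> stands in for an ordering of the indices. A contributing
  permutation never increases \<open>m\<close>, and strictly decreases it somewhere unless it is the
  identity; but permuting preserves the total of \<open>m\<close>.\<close>

lemma det_triangular_wrt_measure:
  fixes A :: "real ^ 'n ^ 'n" and m :: "'n \<Rightarrow> nat"
  assumes "\<And>i j. A $ i $ j \<noteq> 0 \<Longrightarrow> i = j \<or> m j < m i"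
  shows "det A = (\<Prod>i\<in>UNIV. A $ i $ i)"
proof -
  have "(\<Prod>i\<in>UNIV. A $ i $ p i) = 0" if p: "p permutes UNIV" "p \<noteq> id" for p
  proof (rule ccontr)
    assume "(\<Prod>i\<in>UNIV. A $ i $ p i) \<noteq> 0"
    then have nz: "\<And>i. A $ i $ p i \<noteq> 0"
      by (simp add: prod_zero_iff)
    then have "m (p i) \<le> m i" for i
      using assms by (metis less_imp_le order_refl)
    moreover obtain i where "p i \<noteq> i"
      using p by (auto simp: fun_eq_iff)
    then have "m (p i) < m i"
      using assms nz by metis
    ultimately have "(\<Sum>i\<in>UNIV. m (p i)) < (\<Sum>i\<in>UNIV. m i)"
      by (intro sum_strict_mono_ex1) auto
    moreover have "(\<Sum>i\<in>UNIV. m (p i)) = (\<Sum>i\<in>UNIV. m i)"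
      using sum.permute[OF p(1), of m] by (simp add: o_def)
    ultimately show False by simp
  qed
  then have "det A = (\<Sum>p\<in>{id}. of_int (sign p) * (\<Prod>i\<in>UNIV. A $ i $ p i))"
    unfolding det_def by (intro sum.mono_neutral_right) (auto simp: permutes_id finite_permutations)
  then show ?thesis by (simp add: sign_id)
qed

lemma det_zero_if_kernel:
  fixes A :: "real ^ 'n ^ 'n"
  assumes "A *v x = 0" "x \<noteq> 0"
  shows "det A = 0"
  using assms by (metis invertible_det_nz invertible_def matrix_left_invertible_ker)

text \<open>The incidence vector of an edge for an arbitrarily chosen orientation; only expressions
  that do not depend on its sign are used.\<close>

definition edge_vec :: "'n::finite set \<Rightarrow> real ^ 'n" where
  "edge_vec e = (SOME x. \<exists>a b. e = {a, b} \<and> a \<noteq> b \<and> x = axis a 1 - axis b 1)"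

lemma edge_vec_cases:
  assumes "a \<noteq> b"
  shows "edge_vec {a, b} = axis a 1 - axis b 1 \<or> edge_vec {a, b} = axis b 1 - axis a 1"
proof -
  have "\<exists>c d. {a, b} = {c, d} \<and> c \<noteq> d \<and> edge_vec {a, b} = axis c 1 - axis d 1"
    unfolding edge_vec_def by (rule someI_ex) (use assms in blast)
  then show ?thesis
    by (auto simp: doubleton_eq_iff)
qed

lemma edge_vec_outer:
  assumes "a \<noteq> b"
  shows "edge_vec {a, b} $ i * edge_vec {a, b} $ j
    = (axis a 1 - axis b 1) $ i * (axis a 1 - axis b 1) $ j"
proof -
  have "edge_vec {a, b} = axis a 1 - axis b 1 \<or> edge_vec {a, b} = - (axis a 1 - axis b 1)"
    using edge_vec_cases[OF assms] by simp
  then show ?thesis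
    by (elim disjE) (simp_all only: vector_uminus_component minus_mult_minus)
qed

lemma inner_edge_vec:
  assumes "a \<noteq> b"
  shows "(edge_vec {a, b} \<bullet> x = 0) \<longleftrightarrow> x $ a = x $ b"
  using edge_vec_cases[OF assms] by (auto simp: inner_diff_left inner_axis')

lemma laplacian_eq_sum:
  fixes E :: "'n::finite set set"
  assumes "simple_graph E"
  shows "laplacian E = (\<chi> u v. \<Sum>e\<in>E. edge_vec e $ u * edge_vec e $ v)"
proof -
  have "(\<Sum>e\<in>E. edge_vec e $ u * edge_vec e $ v)
      = (\<Sum>e\<in>E. if u = v then (if u \<in> e then 1 else 0) else if e = {u, v} then - 1 else 0)" for u v
  proof (rule sum.cong[OF refl])
    fix e assume "e \<in> E"
    then obtain a b where e: "e = {a, b}" "a \<noteq> b"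
      using assms by (auto simp: simple_graph_def card_2_iff)
    then show "edge_vec e $ u * edge_vec e $ v
        = (if u = v then (if u \<in> e then 1 else 0) else if e = {u, v} then - 1 else 0)"
      by (auto simp: edge_vec_outer axis_def doubleton_eq_iff)
  qed
  moreover have "(\<Sum>e\<in>E. if u \<in> e then 1 else 0 :: real) = card {e \<in> E. u \<in> e}" for u
    by (simp add: sum.If_cases Int_def)
  \<comment> \<open>Since \<open>{u, u} = {u}\<close>, this makes the diagonal of the adjacency
    matrix vanish.\<close>
  moreover have "{u} \<notin> E" for u
    using assms by (auto simp: simple_graph_def)
  ultimately show ?thesis
    by (auto simp: laplacian_def degree_matrix_def adjacency_matrix_def vec_eq_iff sum.delta')
qed

lemma laplacian_mult_vec:
  fixes E :: "'n::finite set set"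
  assumes "simple_graph E"
  shows "laplacian E *v x = (\<Sum>e\<in>E. (edge_vec e \<bullet> x) *\<^sub>R edge_vec e)"
proof -
  have "(\<Sum>v\<in>UNIV. (\<Sum>e\<in>E. edge_vec e $ u * edge_vec e $ v) * x $ v)
      = (\<Sum>e\<in>E. (\<Sum>v\<in>UNIV. edge_vec e $ v * x $ v) * edge_vec e $ u)" for u
    unfolding sum_distrib_right by (subst sum.swap) (simp add: algebra_simps)
  then show ?thesis
    by (simp add: laplacian_eq_sum[OF assms] matrix_vector_mult_def vec_eq_iff inner_vec_def)
qed

text \<open>The quadratic form of the Laplacian is the sum over the edges of the squared differences
  of \<open>x\<close> at the endpoints.\<close>

lemma laplacian_kernel:
  fixes E :: "'n::finite set set"
  assumes "simple_graph E"
  shows "laplacian E *v x = 0 \<longleftrightarrow> (\<forall>a b. {a, b} \<in> E \<longrightarrow> x $ a = x $ b)"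
proof
  assume "laplacian E *v x = 0"
  then have "0 = x \<bullet> (laplacian E *v x)"
    by simp
  also have "\<dots> = (\<Sum>e\<in>E. (edge_vec e \<bullet> x)\<^sup>2)"
    by (simp add: laplacian_mult_vec[OF assms] inner_sum_right power2_eq_square inner_commute)
  finally have "edge_vec e \<bullet> x = 0" if "e \<in> E" for e
    using that by (simp add: sum_nonneg_eq_0_iff)
  then show "\<forall>a b. {a, b} \<in> E \<longrightarrow> x $ a = x $ b"
    by (metis inner_edge_vec)
next
  assume x: "\<forall>a b. {a, b} \<in> E \<longrightarrow> x $ a = x $ b"
  have "edge_vec e \<bullet> x = 0" if "e \<in> E" for e
  proof -
    obtain a b where "e = {a, b}" "a \<noteq> b"
      using assms \<open>e \<in> E\<close> by (auto simp: simple_graph_def card_2_iff)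
    with x that show ?thesis by (simp add: inner_edge_vec)
  qed
  then show "laplacian E *v x = 0"
    by (simp add: laplacian_mult_vec[OF assms])
qed

abbreviation all_ones :: "real ^ 'n ^ 'n" where
  "all_ones \<equiv> \<chi> i j. 1"

lemma det_disconnected:
  fixes T :: "'n::finite set set"
  assumes T: "simple_graph T" and disc: "\<not> graph_connected T"
  shows "det (all_ones + laplacian T) = 0"
proof -
  obtain u v where uv: "(u, v) \<notin> (adj_rel T)\<^sup>*"
    using disc by (auto simp: graph_connected_iff)
  define C where "C = {w. (u, w) \<in> (adj_rel T)\<^sup>*}"
  \<comment> \<open>A kernel vector of both summands: constant on each side of the cut, hence killed
    by the Laplacian, with values balanced to total zero, hence killed by \<open>all_ones\<close>.
    It is nonzero at \<open>u\<close> because \<open>v\<close> lies outside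
    \<open>C\<close>.\<close>
  define x :: "real ^ 'n"
    where "x = (\<chi> w. if w \<in> C then real (card (- C)) else - real (card C))"
  have "x $ a = x $ b" if "{a, b} \<in> T" for a b
  proof -
    have "(a, b) \<in> adj_rel T" "(b, a) \<in> adj_rel T"
      using that by (auto simp: adj_rel_def insert_commute)
    then have "a \<in> C \<longleftrightarrow> b \<in> C"
      unfolding C_def by (auto intro: rtrancl_into_rtrancl)
    then show ?thesis by (simp add: x_def)
  qed
  then have "laplacian T *v x = 0"
    by (simp add: laplacian_kernel[OF T])
  moreover have "(\<Sum>w\<in>UNIV. x $ w) = 0"
    by (simp add: x_def sum.If_cases)
  then have "all_ones *v x = 0"
    by (simp add: matrix_vector_mult_def vec_eq_iff)
  ultimately have "(all_ones + laplacian T) *v x = 0"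
    by (simp add: matrix_vector_mult_add_rdistrib)
  moreover have "x $ u \<noteq> 0"
    using uv by (auto simp: x_def C_def)
  ultimately show ?thesis
    using det_zero_if_kernel by fastforce
qed

text \<open>The matrix factors as \<open>transpose B ** B\<close>, where row \<open>r\<close> of
  \<open>B\<close> is all ones and row \<open>v\<close> is the edge from \<open>v\<close> to its
  parent. Then \<open>det B = CARD('n)\<close>.\<close>

lemma det_tree:
  fixes T :: "'n::finite set set"
  assumes conn: "graph_connected T" and T: "simple_graph T" and card: "card T = CARD('n) - 1"
  shows "det (all_ones + laplacian T) = (real CARD('n))\<^sup>2"
proof -
  fix r :: 'n
  obtain p d where p: "\<And>v. v \<noteq> r \<Longrightarrow> {v, p v} \<in> T" and d: "\<And>v. v \<noteq> r \<Longrightarrow> (d (p v) :: nat) < d v"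
    using connected_parents[OF conn] by metis
  have pv: "p v \<noteq> v" if "v \<noteq> r" for v
    using d[OF that] by auto
  have "card ((\<lambda>v. {v, p v}) ` (- {r})) = CARD('n) - 1"
    using d by (rule card_parent_edges)
  then have T_eq: "T = (\<lambda>v. {v, p v}) ` (- {r})"
    using p card by (intro card_subset_eq[symmetric]) auto
  have inj: "inj_on (\<lambda>v. {v, p v}) (- {r})"
    using d by (rule parent_edges_inj)
  define B :: "real ^ 'n ^ 'n"
    where "B = (\<chi> v. if v = r then 1 else axis v 1 - axis (p v) 1)"
  have "all_ones + laplacian T = transpose B ** B"
  proof -
    have "(\<Sum>e\<in>T. edge_vec e $ i * edge_vec e $ j) = (\<Sum>v\<in>- {r}. B $ v $ i * B $ v $ j)" for i j
    proof -
      have "(\<Sum>e\<in>T. edge_vec e $ i * edge_vec e $ j)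
          = (\<Sum>v\<in>- {r}. edge_vec {v, p v} $ i * edge_vec {v, p v} $ j)"
        by (subst T_eq, subst sum.reindex[OF inj]) simp_all
      also have "\<dots> = (\<Sum>v\<in>- {r}. B $ v $ i * B $ v $ j)"
        using pv by (intro sum.cong refl) (simp add: B_def edge_vec_outer not_sym)
      finally show ?thesis .
    qed
    moreover have "(\<Sum>v\<in>UNIV. B $ v $ i * B $ v $ j)
        = 1 + (\<Sum>v\<in>- {r}. B $ v $ i * B $ v $ j)" for i j
      by (subst sum.remove[of UNIV r]) (auto simp: B_def Compl_eq_Diff_UNIV)
    ultimately show ?thesis
      by (simp add: laplacian_eq_sum[OF T] vec_eq_iff matrix_matrix_mult_def transpose_def)
  qed
  moreover have "det B = real CARD('n)"
  proof -
    \<comment> \<open>Column \<open>r\<close> is replaced by the sum of all columns. The determinant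
      is unchanged, and the new column is zero outside row \<open>r\<close>.\<close>
    define B' :: "real ^ 'n ^ 'n"
      where "B' = (\<chi> i j. if j = r then (B *v 1) $ i else B $ i $ j)"
    have "det B = det B'"
      using cramer_lemma[of r B 1] by (simp add: B'_def)
    have B1: "(B *v 1) $ i = (if i = r then real CARD('n) else 0)" for i
      by (auto simp: B_def matrix_vector_mult_def sum_subtractf axis_def)
    \<comment> \<open>Row \<open>r\<close> has no zero entry, so the root is ranked above every
      depth. Any other row meets only its own column and that of its parent, whose depth is
      smaller.\<close>
    define m where "m v = (if v = r then Suc (Max (range d)) else d v)" for v
    have "det B' = (\<Prod>i\<in>UNIV. B' $ i $ i)"
    proof (rule det_triangular_wrt_measure[of _ m])
      fix i j assume nz: "B' $ i $ j \<noteq> 0"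
      show "i = j \<or> m j < m i"
      proof (cases "i = r")
        case True
        then show ?thesis
          by (auto simp: m_def less_Suc_eq_le)
      next
        case False
        with nz have j: "j \<noteq> r"
          by (auto simp: B'_def B1)
        with nz False have "j = i \<or> j = p i"
          by (auto simp: B'_def B_def axis_def split: if_splits)
        with j False d[of i] show ?thesis by (auto simp: m_def)
      qed
    qed
    also have "\<dots> = (\<Prod>i\<in>UNIV. if i = r then real CARD('n) else 1)"
    proof (intro prod.cong refl)
      fix i
      have "B $ i $ i = 1" if "i \<noteq> r"
        using that pv[OF that] by (simp add: B_def axis_def)
      then show "B' $ i $ i = (if i = r then real CARD('n) else 1)"
        by (simp add: B'_def B1)
    qed
    finally show ?thesis
      using \<open>det B = det B'\<close> by simp
  qed
  ultimately show ?thesis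
    by (simp add: det_mul power2_eq_square)
qed

theorem matrix_tree:
  fixes E :: "'n::finite set set"
  assumes E: "simple_graph E"
  shows "det (all_ones + laplacian E) = (real CARD('n))\<^sup>2 * real (num_spanning_trees E)"
proof -
  \<comment> \<open>The extra index \<open>None\<close> carries the all-ones vector.\<close>
  define w :: "'n set option \<Rightarrow> real ^ 'n" where "w = case_option 1 edge_vec"
  define M where "M S = (\<chi> i j. \<Sum>k\<in>S. w k $ i * w k $ j)" for S
  define K where "K = insert None (Some ` E)"
  have sub: "simple_graph T" if "T \<subseteq> E" for T
    using E that by (auto simp: simple_graph_def)
  have M: "M (insert None (Some ` T)) = all_ones + laplacian T" if "T \<subseteq> E" for T
    by (simp add: M_def w_def laplacian_eq_sum[OF sub[OF that]] vec_eq_iff sum.reindex)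
  \<comment> \<open>Without \<open>None\<close> the partial sum is the Laplacian of a subgraph,
    which is singular because it kills constants.\<close>
  have det_M: "det (M S) = 0" if S: "S \<subseteq> Some ` E" for S
  proof -
    obtain T where T: "T \<subseteq> E" "S = Some ` T"
      using S by (rule subset_imageE)
    have "M S = laplacian T"
      by (simp add: T(2) M_def w_def laplacian_eq_sum[OF sub[OF T(1)]] vec_eq_iff sum.reindex)
    moreover have "laplacian T *v 1 = 0"
      by (simp add: laplacian_kernel[OF sub[OF T(1)]])
    ultimately show ?thesis
      by (metis det_zero_if_kernel one_neq_zero)
  qed
  have det_T: "det (all_ones + laplacian T) = (if is_tree T then (real CARD('n))\<^sup>2 else 0)"
    if "T \<subseteq> E" "card T = CARD('n) - 1" for T
    using that sub det_disconnected[of T] det_tree[of T] connected_card_imp_tree[of T]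
    by (auto simp: is_tree_def)
  have "det (all_ones + laplacian E) = det (M K)"
    by (simp add: K_def M)
  also have "\<dots> = (\<Sum>S | S \<subseteq> K \<and> card S = CARD('n). det (M S))"
    unfolding M_def by (rule det_sum_outer_products) (simp add: K_def)
  also have "\<dots> = (\<Sum>S | S \<subseteq> K \<and> card S = CARD('n) \<and> None \<in> S. det (M S))"
  proof (rule sum.mono_neutral_right)
    show "\<forall>S\<in>{S. S \<subseteq> K \<and> card S = CARD('n)} - {S. S \<subseteq> K \<and> card S = CARD('n) \<and> None \<in> S}.
        det (M S) = 0"
      using det_M by (auto simp: K_def subset_insert)
  qed (auto simp: K_def)
  also have "\<dots> = (\<Sum>T | T \<subseteq> E \<and> card T = CARD('n) - 1. det (M (insert None (Some ` T))))"
  proof (rule sum.reindex_bij_witness[where i = "\<lambda>T. insert None (Some ` T)" and j = "\<lambda>S. Some -` S"])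
    fix S assume "S \<in> {S. S \<subseteq> K \<and> card S = CARD('n) \<and> None \<in> S}"
    then have S: "S \<subseteq> K" "card S = CARD('n)" "None \<in> S" by auto
    show eq: "insert None (Some ` (Some -` S)) = S"
      using S by (auto simp: image_iff)
    have "card (insert None (Some ` (Some -` S))) = Suc (card (Some -` S))"
      by (simp add: card_image card_insert_if del: image_vimage_eq)
    then have "card S = Suc (card (Some -` S))"
      by (simp only: eq)
    then show "Some -` S \<in> {T. T \<subseteq> E \<and> card T = CARD('n) - 1}"
      using S by (auto simp: K_def)
    show "det (M (insert None (Some ` (Some -` S)))) = det (M S)"
      by (simp only: eq)
  next
    fix T assume "T \<in> {T. T \<subseteq> E \<and> card T = CARD('n) - 1}"
    then show "insert None (Some ` T) \<in> {S. S \<subseteq> K \<and> card S = CARD('n) \<and> None \<in> S}"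
      by (auto simp: K_def card_image card_insert_if)
    show "Some -` insert None (Some ` T) = T" by auto
  qed
  also have "\<dots> = (\<Sum>T | T \<subseteq> E \<and> card T = CARD('n) - 1. if is_tree T then (real CARD('n))\<^sup>2 else 0)"
    by (intro sum.cong refl) (use M det_T in auto)
  also have "\<dots> = (\<Sum>T | T \<subseteq> E \<and> is_tree T. (real CARD('n))\<^sup>2)"
    by (rule sum.mono_neutral_cong_right) (auto simp: tree_card sub)
  finally show ?thesis
    by (simp add: num_spanning_trees_def)
qed

section \<open>Laplacian spectrum of a connected graph\<close>

text \<open>\<open>A ** X\<close> and \<open>A ** Y\<close> are symmetric and each absorbs the
  other, so transposing their product identifies them; likewise on the other side. These equalities
  turn \<open>X = X ** A ** X\<close> into \<open>Y\<close>.\<close>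

lemma is_pseudoinverse_unique:
  assumes X: "is_pseudoinverse A X" and Y: "is_pseudoinverse A Y"
  shows "X = Y"
proof -
  have "A ** X = transpose ((A ** Y) ** (A ** X))"
    using X Y by (metis is_pseudoinverse_def matrix_mul_assoc)
  also have "\<dots> = (A ** X) ** (A ** Y)"
    using X Y unfolding is_pseudoinverse_def by (metis matrix_transpose_mul)
  also have "\<dots> = A ** Y"
    using X by (metis is_pseudoinverse_def matrix_mul_assoc)
  finally have AX: "A ** X = A ** Y" .
  have "X ** A = transpose ((X ** A) ** (Y ** A))"
    using X Y by (metis is_pseudoinverse_def matrix_mul_assoc)
  also have "\<dots> = (Y ** A) ** (X ** A)"
    using X Y unfolding is_pseudoinverse_def by (metis matrix_transpose_mul)
  also have "\<dots> = Y ** A"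
    using X by (metis is_pseudoinverse_def matrix_mul_assoc)
  finally have XA: "X ** A = Y ** A" .
  have "X = X ** (A ** X)"
    using X by (metis is_pseudoinverse_def matrix_mul_assoc)
  also have "\<dots> = (Y ** A) ** Y"
    unfolding AX by (simp add: matrix_mul_assoc XA)
  also have "\<dots> = Y"
    using Y by (simp add: is_pseudoinverse_def)
  finally show ?thesis .
qed

lemma pseudoinverse_eqI: "is_pseudoinverse A X \<Longrightarrow> pseudoinverse A = X"
  unfolding pseudoinverse_def by (blast intro: is_pseudoinverse_unique)

text \<open>The convention \<open>inverse 0 = 0\<close> inverts exactly the nonzero eigenvalues and
  keeps the kernel.\<close>

lemma (in orthonormal_family) pseudoinverse_spectral_matrix:
  "pseudoinverse (spectral_matrix q d) = spectral_matrix q (\<lambda>i. inverse (d i))"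
proof (rule pseudoinverse_eqI)
  have inv: "d i * inverse (d i) * d i = d i" "inverse (d i) * d i * inverse (d i) = inverse (d i)" for i
    by (cases "d i = 0"; simp)+
  show "is_pseudoinverse (spectral_matrix q d) (spectral_matrix q (\<lambda>i. inverse (d i)))"
    by (simp only: is_pseudoinverse_def spectral_matrix_mult transpose_spectral_matrix inv simp_thms)
qed

text \<open>Index \<open>r\<close> marks the constant eigenvector, so \<open>- {r}\<close> indexes
  the nonzero Laplacian eigenvalues with multiplicity, in no particular order.\<close>

locale connected_laplacian = orthonormal_family q for q :: "'n::finite \<Rightarrow> real ^ 'n" +
  fixes E :: "'n set set" and lam :: "'n \<Rightarrow> real" and r :: 'n
  assumes simple: "simple_graph E"
    and connected: "graph_connected E"
    and laplacian_eq: "laplacian E = spectral_matrix q lam"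
    and qr: "q r = (1 / sqrt (real CARD('n))) *\<^sub>R 1"
    and lam_r [simp]: "lam r = 0"
    and lam_pos: "i \<noteq> r \<Longrightarrow> lam i > 0"

lemma laplacian_kernel_connected:
  fixes E :: "'n::finite set set"
  assumes "simple_graph E" "graph_connected E" "laplacian E *v x = 0"
  shows "x $ a = x $ b"
proof -
  have "(a, b) \<in> (adj_rel E)\<^sup>*"
    using assms(2) by (simp add: graph_connected_iff)
  then show ?thesis
    by induction (use assms in \<open>auto simp: adj_rel_def laplacian_kernel\<close>)
qed

lemma connected_laplacian_exists:
  fixes E :: "'n::finite set set"
  assumes E: "simple_graph E" "graph_connected E"
  obtains q lam r where "connected_laplacian q E lam r"
proof -
  define c where "c = 1 / sqrt (real CARD('n))"
  have c: "c * c * real CARD('n) = 1" "c > 0"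
    by (simp_all add: c_def)
  define u :: "real ^ 'n" where "u = c *\<^sub>R 1"
  have u: "u \<bullet> u = 1"
    using c by (simp add: u_def inner_vec_def mult.commute)
  have Lu: "laplacian E *v u = 0"
    by (simp add: laplacian_kernel[OF E(1)] u_def)
  have "transpose (laplacian E) = laplacian E"
    by (simp add: laplacian_eq_sum[OF E(1)] transpose_def mult.commute)
  moreover have "norm u = 1" "laplacian E *v u = 0 *\<^sub>R u"
    using u Lu by (simp_all add: norm_eq_1)
  ultimately obtain q :: "'n \<Rightarrow> real ^ 'n" and r lam where q: "q r = u" "\<And>i j. q i \<bullet> q j = (if i = j then 1 else 0)"
    and eig: "\<And>i. laplacian E *v q i = lam i *\<^sub>R q i"
    by (rule symmetric_matrix_orthonormal_eigenbasis) blast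
  interpret orthonormal_family q
    by standard (rule q)
  have "lam r = 0"
    using eig[of r] Lu u q(1) by auto
  moreover have "lam i > 0" if "i \<noteq> r" for i
  proof -
    have "lam i = q i \<bullet> (laplacian E *v q i)"
      by (simp add: eig q(2))
    also have "\<dots> = (\<Sum>e\<in>E. (edge_vec e \<bullet> q i)\<^sup>2)"
      by (simp add: laplacian_mult_vec[OF E(1)] inner_sum_right power2_eq_square inner_commute)
    also have "\<dots> \<ge> 0"
      by (intro sum_nonneg) simp
    finally have "lam i \<ge> 0" .
    moreover have "lam i \<noteq> 0"
    proof
      \<comment> \<open>A second null eigenvector would be constant by connectedness, hence a
        multiple of \<open>q r\<close>, and also orthogonal to \<open>q r\<close>.\<close>
      assume "lam i = 0"
      then have "q i $ a = q i $ r" for a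
        using laplacian_kernel_connected[OF E, of "q i"] eig by simp
      then have qi: "q i = (q i $ r / c) *\<^sub>R q r"
        using c by (simp add: vec_eq_iff q(1) u_def)
      have "q i $ r / c = 0"
        using q(2)[of i r] that u by (subst (asm) qi) (simp add: q(1))
      then have "q i = 0"
        by (subst qi) simp
      then show False
        using q(2)[of i i] by simp
    qed
    ultimately show ?thesis by simp
  qed
  ultimately have "connected_laplacian q E lam r"
    using E q(1) matrix_eq_spectral_matrix[OF eig]
    by unfold_locales (auto simp: u_def c_def)
  with that show ?thesis .
qed

context connected_laplacian
begin

text \<open>\<open>all_ones\<close> has eigenvalue \<open>CARD('n)\<close> on \<open>q r\<close> and
  0 on the rest of the basis, so adding it only replaces the zero eigenvalue of the
  Laplacian.\<close>

lemma det_ones_plus_laplacian: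
  "det (all_ones + laplacian E) = real CARD('n) * (\<Prod>i\<in>- {r}. lam i)"
proof -
  have "all_ones + laplacian E = spectral_matrix q (\<lambda>i. if i = r then real CARD('n) else lam i)"
  proof (rule matrix_eq_spectral_matrix)
    fix i
    have "all_ones *v q i = (if i = r then real CARD('n) else 0) *\<^sub>R q i"
    proof -
      have "(\<Sum>v\<in>UNIV. q i $ v) = sqrt (real CARD('n)) * (q r \<bullet> q i)"
        by (simp add: qr inner_vec_def sum_divide_distrib[symmetric])
      also have "\<dots> = (if i = r then sqrt (real CARD('n)) else 0)"
        by (simp add: orthonormal)
      finally show ?thesis
        by (auto simp: vec_eq_iff matrix_vector_mult_def qr real_div_sqrt)
    qed
    then show "(all_ones + laplacian E) *v q i = (if i = r then real CARD('n) else lam i) *\<^sub>R q i"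
      by (simp add: matrix_vector_mult_add_rdistrib laplacian_eq spectral_matrix_mult_eigenvec)
  qed
  then have "det (all_ones + laplacian E) = (\<Prod>i\<in>UNIV. if i = r then real CARD('n) else lam i)"
    by (simp add: det_spectral_matrix)
  also have "\<dots> = real CARD('n) * (\<Prod>i\<in>- {r}. lam i)"
    by (subst prod.remove[of _ r]) (auto simp: Compl_eq_Diff_UNIV intro!: prod.cong)
  finally show ?thesis .
qed

lemma prod_eigenvalues: "(\<Prod>i\<in>- {r}. lam i) = real CARD('n) * real (num_spanning_trees E)"
  using matrix_tree[OF simple] det_ones_plus_laplacian by (simp add: power2_eq_square)

text \<open>With \<open>d r = 0\<close> the matrix kills constants, so its rows sum to zero. The
  mixed terms disappear and twice \<open>CARD('n)\<close> times the trace remains. Both indices are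
  instances.\<close>

lemma sum_distances_spectral_matrix:
  assumes "d r = 0"
  defines "M \<equiv> spectral_matrix q d"
  shows "(\<Sum>u\<in>UNIV. \<Sum>v\<in>UNIV. M $ u $ u + M $ v $ v - 2 * M $ u $ v)
    = 2 * real CARD('n) * (\<Sum>i\<in>- {r}. d i)"
proof -
  have "M *v q r = 0"
    by (simp add: M_def spectral_matrix_mult_eigenvec assms)
  then have "M *v 1 = 0"
    by (simp add: qr matrix_vector_mult_scaleR)
  then have "(\<Sum>v\<in>UNIV. M $ u $ v) = 0" for u
    by (simp add: vec_eq_iff matrix_vector_mult_def)
  then have "(\<Sum>u\<in>UNIV. \<Sum>v\<in>UNIV. M $ u $ u + M $ v $ v - 2 * M $ u $ v)
      = 2 * real CARD('n) * trace M"
    by (simp add: sum.distrib sum_subtractf sum_distrib_left[symmetric] trace_def)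
  also have "trace M = (\<Sum>i\<in>- {r}. d i)"
    unfolding M_def trace_spectral_matrix
    by (subst sum.remove[of _ r]) (auto simp: assms Compl_eq_Diff_UNIV)
  finally show ?thesis .
qed

lemma biharmonic_index_eq:
  "biharmonic_index E = real CARD('n) * (\<Sum>i\<in>- {r}. (inverse (lam i))\<^sup>2)"
  using sum_distances_spectral_matrix[of "\<lambda>i. (inverse (lam i))\<^sup>2"]
  by (simp add: biharmonic_index_def biharmonic_dist_sq_def Let_def laplacian_eq spectral_matrix_mult
      pseudoinverse_spectral_matrix power2_eq_square)

text \<open>\<open>X\<close> is the pseudoinverse of the Laplacian. It yields a potential because
  \<open>axis u 1 - axis v 1\<close> is orthogonal to the kernel, and two potentials differ by a
  constant, which the difference at \<open>u\<close> and \<open>v\<close> ignores.\<close>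

lemma resistance_dist_eq:
  defines "X \<equiv> spectral_matrix q (\<lambda>i. inverse (lam i))"
  shows "resistance_dist E u v = X $ u $ u + X $ v $ v - 2 * X $ u $ v"
  unfolding resistance_dist_def
proof (rule the_equality)
  define a :: "real ^ 'n" where "a = axis u 1 - axis v 1"
  define p where "p = X *v a"
  have "X $ v $ u = X $ u $ v"
    using transpose_spectral_matrix unfolding X_def transpose_def by (metis vec_lambda_beta)
  then have p_diff: "p $ u - p $ v = X $ u $ u + X $ v $ v - 2 * X $ u $ v"
    by (simp add: p_def a_def matrix_vector_mult_diff_distrib matrix_vector_mult_basis column_def)
  have "q r \<bullet> a = 0"
    by (simp add: a_def qr inner_diff_right inner_axis)
  then have coeff: "lam i * inverse (lam i) * (q i \<bullet> a) = q i \<bullet> a" for i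
    using lam_pos[of i] by (cases "i = r") auto
  have "laplacian E *v p = spectral_matrix q (\<lambda>i. lam i * inverse (lam i)) *v a"
    by (simp add: p_def X_def laplacian_eq matrix_vector_mul_assoc spectral_matrix_mult)
  also have "\<dots> = a"
    unfolding spectral_matrix_mult_vec coeff by (rule expansion[symmetric])
  finally have Lp: "laplacian E *v p = axis u 1 - axis v 1"
    by (simp add: a_def)
  then show "\<exists>p. laplacian E *v p = axis u 1 - axis v 1
      \<and> X $ u $ u + X $ v $ v - 2 * X $ u $ v = p $ u - p $ v"
    using p_diff by metis
  show "x = X $ u $ u + X $ v $ v - 2 * X $ u $ v"
    if x: "\<exists>p. laplacian E *v p = axis u 1 - axis v 1 \<and> x = p $ u - p $ v" for x
  proof -
    obtain p' where p': "laplacian E *v p' = axis u 1 - axis v 1" "x = p' $ u - p' $ v"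
      using x by blast
    then have "laplacian E *v (p' - p) = 0"
      by (simp add: matrix_vector_mult_diff_distrib Lp)
    from laplacian_kernel_connected[OF simple connected this, of u v] show ?thesis
      using p'(2) p_diff by simp
  qed
qed

lemma kirchhoff_index_eq:
  "kirchhoff_index E = real CARD('n) * (\<Sum>i\<in>- {r}. inverse (lam i))"
  using sum_distances_spectral_matrix[of "\<lambda>i. inverse (lam i)"]
  by (simp add: kirchhoff_index_def resistance_dist_eq)

end

section \<open>The bounds on the biharmonic index\<close>

theorem theorem4p2:
  fixes E :: "'n::finite set set" and n :: nat
  assumes "simple_graph E"
    and "graph_connected E"
    and "n = CARD('n)"
    and "n \<ge> 3"
  shows "(kirchhoff_index E)\<^sup>2 / (real n * (real n - 2))
           - real n * (real n - 1) / (real n - 2)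
             * (1 / (real n * real (num_spanning_trees E))) powr (2 / (real n - 1))
         \<le> biharmonic_index E
       \<and> biharmonic_index E
         \<le> (kirchhoff_index E)\<^sup>2 / real n
           - real n * (real n - 1) * (real n - 2)
             * (1 / (real n * real (num_spanning_trees E))) powr (2 / (real n - 1))"
proof -
  obtain q lam r where "connected_laplacian q E lam r"
    using connected_laplacian_exists assms by blast
  then interpret connected_laplacian q E lam r .
  define A where "A = - {r}"
  define x where "x = (\<lambda>i. inverse (lam i))"
  define S Q where "S = (\<Sum>i\<in>A. x i)" and "Q = (\<Sum>i\<in>A. (x i)\<^sup>2)"
  define P where "P = 1 / (real n * real (num_spanning_trees E))"
  define G where "G = P powr (2 / (real n - 1))"
  have cA: "real (card A) = real n - 1"
    using assms by (simp add: A_def Compl_eq_Diff_UNIV of_nat_diff)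
  then have A: "A \<noteq> {}" using assms(4) by auto
  have x: "x i > 0" if "i \<in> A" for i
    using that lam_pos by (simp add: x_def A_def)
  have "(\<Prod>i\<in>A. x i) = P"
    using prod_eigenvalues assms(3)
    by (simp add: P_def x_def A_def prod_inversef[symmetric] o_def inverse_eq_divide prod_dividef)
  \<comment> \<open>Positivity of \<open>P\<close> comes from the eigenvalues; it lets
    \<open>powr\<close> unfold to an exponential of the sum of logarithms.\<close>
  moreover have "(\<Prod>i\<in>A. x i) > 0"
    using x by (simp add: prod_pos)
  moreover have "ln (\<Prod>i\<in>A. x i) = (\<Sum>i\<in>A. ln (x i))"
    by (intro ln_prod) (auto dest: x)
  ultimately have G: "exp (2 * (\<Sum>i\<in>A. ln (x i)) / (real n - 1)) = G"
    by (simp add: G_def powr_def cA)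
  have lower: "S\<^sup>2 \<le> (real n - 2) * Q + (real n - 1) * G"
    using kober_inequality[of A x] A x by (simp add: G cA S_def Q_def)
  have upper: "(real n - 1) * (real n - 2) * G \<le> S\<^sup>2 - Q"
    using maclaurin_two[of A x] A x by (simp add: G cA S_def Q_def)
  have Kf: "kirchhoff_index E = real n * S" and BH: "biharmonic_index E = real n * Q"
    by (simp_all add: kirchhoff_index_eq biharmonic_index_eq S_def Q_def x_def A_def assms(3))
  have n: "real n \<ge> 3" using assms(4) by simp
  have "real n * (S\<^sup>2 - (real n - 1) * G) \<le> real n * ((real n - 2) * Q)"
    using lower n by (intro mult_left_mono) auto
  moreover have "(real n * S)\<^sup>2 / (real n * (real n - 2)) - real n * (real n - 1) / (real n - 2) * G
      = real n * (S\<^sup>2 - (real n - 1) * G) / (real n - 2)"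
  proof -
    \<comment> \<open>The difference \<open>real n - 2\<close> is generalized to an atom
      \<open>d\<close> for clearing denominators.\<close>
    have "(real n * S)\<^sup>2 / (real n * d) - real n * (real n - 1) / d * G
        = real n * (S\<^sup>2 - (real n - 1) * G) / d" if "d > 0" for d
      using n that by (simp add: field_simps power2_eq_square)
    from this[of "real n - 2"] n show ?thesis by simp
  qed
  ultimately have "(real n * S)\<^sup>2 / (real n * (real n - 2))
      - real n * (real n - 1) / (real n - 2) * G \<le> real n * Q"
    using n by (simp add: pos_divide_le_eq mult_ac)
  moreover have "real n * Q \<le> (real n * S)\<^sup>2 / real n - real n * (real n - 1) * (real n - 2) * G"
    using mult_left_mono[OF upper, of "real n"] n by (simp add: power2_eq_square algebra_simps)
  ultimately show ?thesis
    unfolding Kf BH P_def[symmetric] G_def[symmetric] by blast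
qed

end
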